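(* Suppose that $\varphi=f+g$ satisfies the quadratic growth with constants $(\mu,\beta)$, $\mu,\beta>0$, and let $(x^k)_{k\in\mathbb N}$ be generated by algorithm FBTN (described in the context). Then the values of $\varphi_\gamma$ decrease $Q$-linearly along the iterates: $$\varphi_\gamma(x^{k+1})-\varphi_\star\le\left(1-\frac{2\sigma\mu'}{\gamma\mu+2(2+\gamma\mu')(1+\gamma L_f)^2}\right)\bigl(\varphi_\gamma(x^k)-\varphi_\star\bigr)\qquad\forall k\in\mathbb N,$$ where $$\mu'=\begin{cases}\mu&\text{if }\varphi_\gamma(x^0)\le\varphi_\star+\beta,\\[2pt]\frac\mu2\min\left\{1,\frac{\beta}{\varphi_\gamma(x^0)-\varphi_\star-\beta}\right\}&\text{otherwise.}\end{cases}$$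
   Context: Setting: $f:\mathbb R^n\to\mathbb R$ is convex, twice continuously differentiable, with $L_f$-Lipschitz continuous gradient ($L_f>0$); $g:\mathbb R^n\to\mathbb R\cup\{\infty\}$ is proper, convex and lower semicontinuous; $\varphi=f+g$, $\varphi_\star=\inf\varphi$, $\mathcal X_\star=\operatorname{argmin}\varphi$. It is assumed that $\mathcal X_\star\neq\emptyset$. Quadratic growth of $\varphi$ with constants $(\mu,\beta)$ means: $\varphi(x)-\varphi_\star\ge\frac\mu2\operatorname{dist}(x,\mathcal X_\star)^2$ for all $x$ with $\varphi(x)\le\varphi_\star+\beta$. Notation, for $\gamma>0$: $\operatorname{prox}_{\gamma g}(x)=\operatorname{argmin}_w\{g(w)+\frac1{2\gamma}\|w-x\|^2\}$; $T_\gamma(x)=\operatorname{prox}_{\gamma g}(x-\gamma\nabla f(x))$; $R_\gamma(x)=\frac1\gamma(x-T_\gamma(x))$; $Q_\gamma(x)=I-\gamma\nabla^2 f(x)$. The forward-backward envelope is $\varphi_\gamma(x)=\min_{w\in\mathbb R^n}\{f(x)+\langle\nabla f(x),w-x\rangle+\frac1{2\gamma}\|w-x\|^2+g(w)\}=f(x)-\frac\gamma2\|\nabla f(x)\|^2+g^\gamma(x-\gamma\nabla f(x))$, where $g^\gamma(x)=\min_w\{g(w)+\frac1{2\gamma}\|w-x\|^2\}$; it is continuously differentiable with $\nabla\varphi_\gamma(x)=Q_\gamma(x)R_\gamma(x)$. For a locally Lipschitz map $G$, $\partial_CG(x)$ is the Clarke generalized Jacobian: the convex hull of all limits of Jacobians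 $JG(x^j)$ along sequences $x^j\to x$ of points of differentiability of $G$. The approximate generalized Hessian is $\hat\partial^2\varphi_\gamma(x)=\{\gamma^{-1}Q_\gamma(x)(I-PQ_\gamma(x)) : P\in\partial_C(\operatorname{prox}_{\gamma g})(x-\gamma\nabla f(x))\}$ (nonempty, consisting of symmetric positive semidefinite matrices when $\gamma\le 1/L_f$). Algorithm FBTN. Parameters: $\gamma\in(0,1/L_f)$, $\sigma\in(0,\frac{\gamma(1-\gamma L_f)}2)$, $\bar\eta,\zeta\in(0,1)$, $\rho,\nu\in(0,1]$, initial point $x^0\in\mathbb R^n$. For $k=0,1,2,\dots$: (1) set $\delta_k=\zeta\|\nabla\varphi_\gamma(x^k)\|^\nu$, $\eta_k=\min\{\bar\eta,\|\nabla\varphi_\gamma(x^k)\|^\rho\}$, $\varepsilon_k=\eta_k\|\nabla\varphi_\gamma(x^k)\|$; (2) for some $H_k\in\hat\partial^2\varphi_\gamma(x^k)$, find (by the conjugate gradient method) an $\varepsilon_k$-approximate solution $d^k$ of the linear system $(H_k+\delta_kI)d=-\nabla\varphi_\gamma(x^k)$, i.e. $\|(H_k+\delta_kI)d^k+\nabla\varphi_\gamma(x^k)\|\le\varepsilon_k$; (3) let $\tau_k$ be the maximum in $\{2^{-i}: i=0,1,2,\dots\}$ such that $\varphi_\gamma(x^{k+1})\le\varphi_\gamma(x^k)-\sigma\|R_\gamma(x^k)\|^2$, where $x^{k+1}=(1-\tau_k)T_\gamma(x^k)+\tau_k(x^k+d^k)$. The algorithm is run with infinite accuracy, and it is assumed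 that $R_\gamma(x^k)\ne0$ for all $k$, so that an infinite sequence is generated. *)

theory Defs
  imports "HOL-Analysis.Analysis"
begin

section \<open>Extended-real-valued functions\<close>

definition proper_ereal :: "('a \<Rightarrow> ereal) \<Rightarrow> bool" where
  "proper_ereal g \<longleftrightarrow> (\<forall>x. g x \<noteq> -\<infinity>) \<and> (\<exists>x. g x \<noteq> \<infinity>)"

(* Only meaningful together with properness, which excludes sums of infinities of opposite sign. *)
definition convex_ereal :: "('a::real_vector \<Rightarrow> ereal) \<Rightarrow> bool" where
  "convex_ereal g \<longleftrightarrow>
    (\<forall>x y. \<forall>t\<in>{0<..<1}. g ((1 - t) *\<^sub>R x + t *\<^sub>R y) \<le> ereal (1 - t) * g x + ereal t * g y)"

definition lsc_ereal :: "('a::topological_space \<Rightarrow> ereal) \<Rightarrow> bool" where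
  "lsc_ereal g \<longleftrightarrow> (\<forall>x. g x \<le> Liminf (at x) g)"

definition argmin_set :: "('a \<Rightarrow> ereal) \<Rightarrow> 'a set" where
  "argmin_set \<phi> = {x. is_arg_min \<phi> (\<lambda>_. True) x}"

(* The conversion to real loses nothing when \<phi> is proper and attains its infimum. *)
definition inf_val :: "('a \<Rightarrow> ereal) \<Rightarrow> real" where
  "inf_val \<phi> = real_of_ereal (INF x. \<phi> x)"

definition quadratic_growth :: "('a::metric_space \<Rightarrow> ereal) \<Rightarrow> real \<Rightarrow> real \<Rightarrow> bool" where
  "quadratic_growth \<phi> \<mu> \<beta> \<longleftrightarrow>
    (\<forall>x. \<phi> x \<le> ereal (inf_val \<phi> + \<beta>) \<longrightarrow>
         \<phi> x - ereal (inf_val \<phi>) \<ge> ereal (\<mu> / 2 * (infdist x (argmin_set \<phi>))\<^sup>2))"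


section \<open>Gradient, Hessian, Clarke Jacobian\<close>

definition grad :: "('a::real_inner \<Rightarrow> real) \<Rightarrow> 'a \<Rightarrow> 'a" where
  "grad f x = (THE D. GDERIV f x :> D)"

definition hess :: "(real^'n \<Rightarrow> real) \<Rightarrow> real^'n \<Rightarrow> real^'n^'n" where
  "hess f x = jacobian (grad f) (at x)"

definition twice_cont_diff :: "(real^'n \<Rightarrow> real) \<Rightarrow> bool" where
  "twice_cont_diff f \<longleftrightarrow>
    (\<forall>x. f differentiable (at x)) \<and> (\<forall>x. grad f differentiable (at x)) \<and>
    continuous_on UNIV (hess f)"

definition clarke_jacobian :: "(real^'n \<Rightarrow> real^'m) \<Rightarrow> real^'n \<Rightarrow> (real^'n^'m) set" where
  "clarke_jacobian G x =
    convex hull {A. \<exists>\<xi>. (\<forall>j. G differentiable (at (\<xi> j))) \<and> \<xi> \<longlonglongrightarrow> x \<and>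
                        (\<lambda>j. jacobian G (at (\<xi> j))) \<longlonglongrightarrow> A}"


section \<open>Forward-backward operators\<close>

(* arg_min picks some minimizer; for proper, convex, lsc g and \<gamma> > 0 there is exactly one. *)
definition prox :: "real \<Rightarrow> ('a::real_inner \<Rightarrow> ereal) \<Rightarrow> 'a \<Rightarrow> 'a" where
  "prox \<gamma> g x = (ARG_MIN (\<lambda>w. g w + ereal (1 / (2 * \<gamma>) * (norm (w - x))\<^sup>2)) w. True)"

definition fb_T :: "real \<Rightarrow> ('a::real_inner \<Rightarrow> real) \<Rightarrow> ('a \<Rightarrow> ereal) \<Rightarrow> 'a \<Rightarrow> 'a" where
  "fb_T \<gamma> f g x = prox \<gamma> g (x - \<gamma> *\<^sub>R grad f x)"

definition fb_R :: "real \<Rightarrow> ('a::real_inner \<Rightarrow> real) \<Rightarrow> ('a \<Rightarrow> ereal) \<Rightarrow> 'a \<Rightarrow> 'a" where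
  "fb_R \<gamma> f g x = (1 / \<gamma>) *\<^sub>R (x - fb_T \<gamma> f g x)"

definition fb_Q :: "real \<Rightarrow> (real^'n \<Rightarrow> real) \<Rightarrow> real^'n \<Rightarrow> real^'n^'n" where
  "fb_Q \<gamma> f x = mat 1 - \<gamma> *\<^sub>R hess f x"

(* Forward-backward envelope. The minimum is attained and finite for proper, convex, lsc g and
   \<gamma> > 0, so taking the infimum and converting it to a real are harmless. *)
definition fbe :: "real \<Rightarrow> ('a::real_inner \<Rightarrow> real) \<Rightarrow> ('a \<Rightarrow> ereal) \<Rightarrow> 'a \<Rightarrow> real" where
  "fbe \<gamma> f g x = real_of_ereal
    (INF w. ereal (f x + inner (grad f x) (w - x) + 1 / (2 * \<gamma>) * (norm (w - x))\<^sup>2) + g w)"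

definition fbe_approx_hess ::
  "real \<Rightarrow> (real^'n \<Rightarrow> real) \<Rightarrow> (real^'n \<Rightarrow> ereal) \<Rightarrow> real^'n \<Rightarrow> (real^'n^'n) set" where
  "fbe_approx_hess \<gamma> f g x =
    {(1 / \<gamma>) *\<^sub>R (fb_Q \<gamma> f x ** (mat 1 - P ** fb_Q \<gamma> f x)) | P.
      P \<in> clarke_jacobian (prox \<gamma> g) (x - \<gamma> *\<^sub>R grad f x)}"


section \<open>Forward-backward truncated-Newton iterations\<close>

definition fbtn_trial ::
  "real \<Rightarrow> ('a::real_inner \<Rightarrow> real) \<Rightarrow> ('a \<Rightarrow> ereal) \<Rightarrow> 'a \<Rightarrow> 'a \<Rightarrow> real \<Rightarrow> 'a" where
  "fbtn_trial \<gamma> f g x d \<tau> = (1 - \<tau>) *\<^sub>R fb_T \<gamma> f g x + \<tau> *\<^sub>R (x + d)"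

definition fbtn_stepsizes ::
  "real \<Rightarrow> real \<Rightarrow> ('a::real_inner \<Rightarrow> real) \<Rightarrow> ('a \<Rightarrow> ereal) \<Rightarrow> 'a \<Rightarrow> 'a \<Rightarrow> real set" where
  "fbtn_stepsizes \<gamma> \<sigma> f g x d =
    {\<tau>. (\<exists>i::nat. \<tau> = (1 / 2) ^ i) \<and>
        fbe \<gamma> f g (fbtn_trial \<gamma> f g x d \<tau>) \<le> fbe \<gamma> f g x - \<sigma> * (norm (fb_R \<gamma> f g x))\<^sup>2}"

(* The inner conjugate gradient solver enters only through the residual bound on d that it
   guarantees; the choice of H and of d is otherwise arbitrary. *)
definition fbtn_step ::
  "real \<Rightarrow> real \<Rightarrow> real \<Rightarrow> real \<Rightarrow> real \<Rightarrow> real \<Rightarrow> (real^'n \<Rightarrow> real) \<Rightarrow> (real^'n \<Rightarrow> ereal) \<Rightarrow>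
   real^'n \<Rightarrow> real^'n \<Rightarrow> bool" where
  "fbtn_step \<gamma> \<sigma> \<eta>bar \<zeta> \<rho> \<nu> f g x x' \<longleftrightarrow>
    (let v = grad (fbe \<gamma> f g) x;
         \<delta> = \<zeta> * norm v powr \<nu>;
         \<eta> = min \<eta>bar (norm v powr \<rho>);
         \<epsilon> = \<eta> * norm v
     in \<exists>H d \<tau>. H \<in> fbe_approx_hess \<gamma> f g x \<and>
          norm ((H + \<delta> *\<^sub>R mat 1) *v d + v) \<le> \<epsilon> \<and>
          \<tau> \<in> fbtn_stepsizes \<gamma> \<sigma> f g x d \<and> (\<forall>t\<in>fbtn_stepsizes \<gamma> \<sigma> f g x d. t \<le> \<tau>) \<and>
          x' = fbtn_trial \<gamma> f g x d \<tau>)"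

end

theory Submission
  imports Defs
begin

text \<open>The line search already gives the decrease \<open>\<sigma> * (norm (fb_R \<gamma> f g y))\<^sup>2\<close> of the envelope,
  whatever the Newton direction, so it suffices to bound the envelope gap by a multiple of the
  squared residual. The forward-backward point \<open>z = fb_T \<gamma> f g y\<close> has
  \<open>v = fb_R \<gamma> f g y - grad f y + grad f z\<close> as a subgradient of \<open>\<phi> = f + g\<close>, of norm at most
  \<open>(1 + \<gamma> * Lf) * norm (fb_R \<gamma> f g y)\<close>. The subgradient inequality at the minimizer nearest to \<open>z\<close>
  bounds the gap \<open>\<phi> z - inf_val \<phi>\<close> by \<open>norm v\<close> times the distance to the minimizers, and quadratic
  growth bounds that distance by a multiple of \<open>norm v\<close>. If the initial level exceeds \<open>\<beta>\<close>, convexity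
  along segments to the minimizers first extends the growth condition to that level, at the price
  of a smaller constant. Optimality of a minimizer of \<open>\<phi>\<close> also yields an affine minorant of \<open>g\<close>,
  which makes the proximal problem coercive.\<close>

section \<open>Gradients, the tangent inequality and the quadratic upper bound\<close>

text \<open>\<open>grad\<close> is a definite description, so existence and uniqueness of the
  representing vector are both owed. The adjoint of the derivative, applied to 1, supplies the
  vector.\<close>

lemma GDERIV_grad:
  fixes f :: "'a::euclidean_space \<Rightarrow> real"
  assumes "f differentiable (at x)"
  shows "GDERIV f x :> grad f x"
proof -
  obtain D where D: "(f has_derivative D) (at x)"
    using assms unfolding differentiable_def by blast
  have "D = (\<lambda>h. inner h (adjoint D 1))"
    using adjoint_works[OF has_derivative_linear[OF D], of _ 1] by auto
  then have ex: "GDERIV f x :> adjoint D 1"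
    unfolding gderiv_def using D by simp
  moreover have "E = adjoint D 1" if "GDERIV f x :> E" for E
    using has_derivative_unique[OF that[unfolded gderiv_def] ex[unfolded gderiv_def]]
    by (metis inner_commute vector_eq_rdot)
  ultimately show ?thesis
    unfolding grad_def by (rule theI)
qed

lemma GDERIV_line:
  assumes "GDERIV f (z + t *\<^sub>R h) :> D"
  shows "((\<lambda>t. f (z + t *\<^sub>R h)) has_real_derivative inner D h) (at t)"
proof -
  have "((\<lambda>t. z + t *\<^sub>R h) has_derivative (\<lambda>s. s *\<^sub>R h)) (at t)"
    by (auto intro!: derivative_eq_intros)
  from has_derivative_compose[OF this assms[unfolded gderiv_def]]
  show ?thesis
    by (simp add: has_field_derivative_def inner_commute mult_commute_abs)
qed

text \<open>The one-sided difference quotients at 0 stay above \<open>c\<close> and converge to the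
  directional derivative. Convexity and minimality are both turned into first-order information
  through this lemma.\<close>

lemma GDERIV_direction_ge:
  assumes "GDERIV f z :> D"
    and "\<And>t. 0 < t \<Longrightarrow> t < 1 \<Longrightarrow> t * c \<le> f (z + t *\<^sub>R h) - f z"
  shows "c \<le> inner D h"
proof -
  have "((\<lambda>t. f (z + t *\<^sub>R h)) has_real_derivative inner D h) (at_right 0)"
    using GDERIV_line[of f z 0 h D] assms(1) by (simp add: has_field_derivative_at_within)
  then have "((\<lambda>t. (f (z + t *\<^sub>R h) - f z) / t) \<longlongrightarrow> inner D h) (at_right 0)"
    by (simp add: has_field_derivative_iff)
  moreover have "\<forall>\<^sub>F t in at_right 0. c \<le> (f (z + t *\<^sub>R h) - f z) / t"
    using eventually_at_right_real[of 0 1] assms(2)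
    by (auto elim!: eventually_mono simp: field_simps)
  ultimately show ?thesis
    by (intro tendsto_lowerbound[where F = "at_right (0::real)"]) auto
qed

lemma convex_on_GDERIV_above_tangent:
  assumes "convex_on UNIV f" "GDERIV f z :> D"
  shows "f z + inner D (w - z) \<le> f w"
proof -
  \<comment> \<open>Convexity bounds the difference quotients of \<open>f\<close> from above, while
    a lower bound is wanted, hence the passage to \<open>- f\<close>.\<close>
  have "- (f w - f z) \<le> inner (- D) (w - z)"
  proof (rule GDERIV_direction_ge[OF GDERIV_minus[OF assms(2)]])
    fix t :: real assume "0 < t" "t < 1"
    then have "f ((1 - t) *\<^sub>R z + t *\<^sub>R w) \<le> (1 - t) * f z + t * f w"
      using convex_onD[OF assms(1), of t z w] by simp
    then show "t * - (f w - f z) \<le> - f (z + t *\<^sub>R (w - z)) - - f z"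
      by (simp add: algebra_simps)
  qed
  then show ?thesis by simp
qed

lemma lipschitz_gradient_descent:
  fixes f :: "'a::real_inner \<Rightarrow> real"
  assumes D: "\<And>z. GDERIV f z :> G z" and lip: "L-lipschitz_on UNIV G"
  shows "f w \<le> f z + inner (G z) (w - z) + L / 2 * (norm (w - z))\<^sup>2"
proof -
  define h where "h = w - z"
  \<comment> \<open>\<open>p\<close> is \<open>f\<close> along the segment minus the first- and
    second-order terms of the claimed bound. The Lipschitz estimate makes its derivative nonpositive
    on [0,1], and \<open>p 1 \<le> p 0\<close> is the claim.\<close>
  define p where "p t = f (z + t *\<^sub>R h) - t * inner (G z) h - L / 2 * t\<^sup>2 * (norm h)\<^sup>2" for t
  have "p 1 \<le> p 0"
  proof (rule DERIV_nonpos_imp_nonincreasing[where f = p and a = 0 and b = 1])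
    fix t :: real assume t: "0 \<le> t" "t \<le> 1"
    have "inner (G (z + t *\<^sub>R h) - G z) h \<le> norm (G (z + t *\<^sub>R h) - G z) * norm h"
      by (rule norm_cauchy_schwarz)
    also have "\<dots> \<le> L * (t * norm h) * norm h"
      using lipschitz_onD[OF lip, of "z + t *\<^sub>R h" z] t
      by (intro mult_right_mono) (auto simp: dist_norm)
    finally have "inner (G (z + t *\<^sub>R h)) h - inner (G z) h - L * t * (norm h)\<^sup>2 \<le> 0"
      by (simp add: inner_diff_left power2_eq_square mult.assoc)
    moreover have "(p has_real_derivative
        inner (G (z + t *\<^sub>R h)) h - inner (G z) h - L * t * (norm h)\<^sup>2) (at t)"
      unfolding p_def by (auto intro!: derivative_eq_intros GDERIV_line[OF D])
    ultimately show "\<exists>y. (p has_real_derivative y) (at t) \<and> y \<le> 0" by blast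
  qed simp
  then show ?thesis by (simp add: p_def h_def)
qed

lemma GDERIV_norm_square:
  "GDERIV (\<lambda>w. c * (norm (w - y))\<^sup>2) z :> (2 * c) *\<^sub>R (z - y)"
  unfolding gderiv_def power2_norm_eq_inner
  by (auto intro!: derivative_eq_intros simp: inner_commute algebra_simps)

section \<open>Optimality conditions and existence of the proximal point\<close>

text \<open>Fermat's rule. By convexity, moving a fraction \<open>t\<close> from \<open>z\<close>
  towards \<open>w\<close> raises \<open>g\<close> by at most \<open>t * (g w - g z)\<close>, so
  minimality bounds the change of \<open>q\<close> from below by the opposite amount; letting
  \<open>t\<close> tend to 0 makes \<open>- D\<close> a subgradient of \<open>g\<close>. It serves
  with \<open>q = f\<close> at a minimizer of the sum and with the proximal quadratic as
  \<open>q\<close>.\<close>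

lemma minimizer_sum_variational:
  fixes g :: "'a::real_inner \<Rightarrow> ereal"
  assumes D: "GDERIV q z :> D" and proper: "proper_ereal g" and cvx: "convex_ereal g"
    and min: "\<And>w. g z + ereal (q z) \<le> g w + ereal (q w)"
  shows "g z + ereal (inner (- D) (w - z)) \<le> g w"
proof (cases "g w")
  case (real gw)
  have "g z \<noteq> -\<infinity>" using proper by (simp add: proper_ereal_def)
  moreover have "g z \<noteq> \<infinity>" using min[of w] real by auto
  ultimately obtain gz where gz: "g z = ereal gz" by (cases "g z") auto
  have "gz - gw \<le> inner D (w - z)"
  proof (rule GDERIV_direction_ge[OF D])
    fix t :: real assume t: "0 < t" "t < 1"
    define u where "u = z + t *\<^sub>R (w - z)"
    have "u = (1 - t) *\<^sub>R z + t *\<^sub>R w" by (simp add: u_def algebra_simps)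
    then have le: "g u \<le> ereal ((1 - t) * gz + t * gw)"
      using cvx t gz real unfolding convex_ereal_def
      by (metis greaterThanLessThan_iff plus_ereal.simps(1) times_ereal.simps(1))
    have "ereal (gz + q z) \<le> g u + ereal (q u)"
      using min[of u] gz by simp
    also have "\<dots> \<le> ereal ((1 - t) * gz + t * gw) + ereal (q u)"
      using le by (rule add_right_mono)
    finally show "t * (gz - gw) \<le> q (z + t *\<^sub>R (w - z)) - q z"
      unfolding u_def[symmetric] by (simp add: algebra_simps)
  qed
  then show ?thesis by (simp add: gz real)
qed (use proper in \<open>auto simp: proper_ereal_def\<close>)

text \<open>Where \<open>q < g\<close>, a real number strictly between the two values separates them
  on a neighbourhood, so the complement is open. A continuous right-hand side covers both the
  sublevel sets of the proximal objective and the minimizers of \<open>f + g\<close>.\<close>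

lemma closed_lsc_le_continuous:
  fixes g :: "'a::topological_space \<Rightarrow> ereal"
  assumes "lsc_ereal g" "continuous_on UNIV q"
  shows "closed {w. g w \<le> ereal (q w)}"
proof -
  have "\<exists>T. open T \<and> w \<in> T \<and> T \<subseteq> {w. ereal (q w) < g w}" if gt: "ereal (q w) < g w" for w
  proof -
    obtain r where r: "ereal (q w) < ereal r" "ereal r < g w"
      using ereal_dense2[OF gt] by blast
    have "\<forall>\<^sub>F v in at w. ereal r < g v"
      using assms(1) r(2) unfolding lsc_ereal_def le_Liminf_iff by blast
    \<comment> \<open>Lower semicontinuity speaks of punctured neighbourhoods;
      \<open>r < g w\<close> adds the centre.\<close>
    then have "\<forall>\<^sub>F v in nhds w. ereal r < g v"
      using r(2) by (simp add: eventually_nhds_conv_at)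
    moreover have "\<forall>\<^sub>F v in nhds w. q v < r"
      using assms(2) r(1) order_tendstoD(2)[of q "q w" "at w" r]
      by (auto simp: eventually_nhds_conv_at continuous_on_def)
    ultimately have "\<forall>\<^sub>F v in nhds w. ereal (q v) < g v"
      by eventually_elim (use less_trans less_ereal.simps(1) in blast)
    then show ?thesis unfolding eventually_nhds by blast
  qed
  then have "open {w. ereal (q w) < g w}"
    by (subst open_subopen) blast
  moreover have "{w. g w \<le> ereal (q w)} = - {w. ereal (q w) < g w}" by auto
  ultimately show ?thesis by (simp add: open_closed)
qed

text \<open>The sublevel sets at attained levels up to \<open>h w0\<close> form a chain of nonempty
  compact sets, and any common point is a minimizer. Restricting closedness to these levels means
  that an extended-real objective is only tested at finite ones.\<close>

lemma closed_bounded_sublevels_attain_min: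
  fixes h :: "'a::heine_borel \<Rightarrow> 'b::linorder"
  assumes "\<And>w. h w \<le> h w0 \<Longrightarrow> closed {v. h v \<le> h w}" "bounded {v. h v \<le> h w0}"
  obtains z where "\<And>w. h z \<le> h w"
proof -
  define F where "F = (\<lambda>w. {v. h v \<le> h w}) ` {w. h w \<le> h w0}"
  have "\<Inter>F \<noteq> {}"
  proof (rule compact_chain)
    show "compact S" if "S \<in> F" for S
      using that assms unfolding F_def
      by (auto simp: compact_eq_bounded_closed intro: bounded_subset)
    show "{} \<notin> F" by (auto simp: F_def)
    show "S \<subseteq> T \<or> T \<subseteq> S" if "S \<in> F \<and> T \<in> F" for S T
      using that unfolding F_def by clarsimp (meson le_cases order_trans)
  qed
  then obtain z where "z \<in> \<Inter>F" by blast
  then have z: "h z \<le> h w" if "h w \<le> h w0" for w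
    using that by (auto simp: F_def)
  have "h z \<le> h w" for w
    using z[of w] z[of w0] by (meson le_cases order_refl order_trans)
  then show thesis by (rule that)
qed

text \<open>\<open>prox\<close> is a choice of minimizer, so it suffices that one exists. The
  quadratic term outgrows the affine minorant, which bounds the sublevel sets.\<close>

lemma prox_minimizes:
  fixes g :: "'a::euclidean_space \<Rightarrow> ereal"
  assumes proper: "proper_ereal g" and lsc: "lsc_ereal g" and "\<gamma> > 0"
    and minorant: "\<And>w. ereal (a + inner v w) \<le> g w"
  shows "g (prox \<gamma> g y) + ereal (1 / (2 * \<gamma>) * (norm (prox \<gamma> g y - y))\<^sup>2)
    \<le> g w + ereal (1 / (2 * \<gamma>) * (norm (w - y))\<^sup>2)"
proof -
  define q where "q w = 1 / (2 * \<gamma>) * (norm (w - y))\<^sup>2" for w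
  define h where "h w = g w + ereal (q w)" for w
  obtain w0 where w0: "g w0 \<noteq> \<infinity>" using proper by (auto simp: proper_ereal_def)
  have ninf: "g w \<noteq> -\<infinity>" for w using proper by (auto simp: proper_ereal_def)
  obtain c where c: "h w0 = ereal c"
    using w0 ninf[of w0] by (cases "g w0") (auto simp: h_def)
  have "\<exists>z. \<forall>w. h z \<le> h w"
  proof (rule closed_bounded_sublevels_attain_min[of h w0])
    fix w assume "h w \<le> h w0"
    then obtain d where d: "h w = ereal d"
      using ninf[of w] c by (cases "g w") (auto simp: h_def)
    \<comment> \<open>Since \<open>d\<close> and \<open>q v\<close> are finite, \<open>q\<close> can
      be moved to the right, which leaves \<open>g\<close> below a continuous real function.\<close>
    have "{v. h v \<le> h w} = {v. g v \<le> ereal (d - q v)}"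
      unfolding d unfolding h_def
    proof (rule Collect_cong)
      fix v
      show "g v + ereal (q v) \<le> ereal d \<longleftrightarrow> g v \<le> ereal (d - q v)"
        by (cases "g v") auto
    qed
    moreover have "continuous_on UNIV (\<lambda>v. d - q v)"
      unfolding q_def by (intro continuous_intros)
    ultimately show "closed {v. h v \<le> h w}"
      using closed_lsc_le_continuous[OF lsc] by simp
  next
    \<comment> \<open>Once the distance \<open>r\<close> to \<open>y\<close> exceeds 1, the constant
      term is absorbed into a multiple of \<open>r\<close>, so that
      \<open>r * r / (2 * \<gamma>) \<le> K * r\<close>. The summand 1 in the bound below covers the
      remaining points.\<close>
    define K where "K = \<bar>c - a - inner v y\<bar> + norm v"
    have "norm (w - y) \<le> 2 * \<gamma> * K + 1" if "h w \<le> h w0" for w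
    proof (cases "norm (w - y) \<le> 1")
      case True
      moreover have "0 \<le> 2 * \<gamma> * K" using \<open>\<gamma> > 0\<close> by (simp add: K_def)
      ultimately show ?thesis by linarith
    next
      case False
      define r where "r = norm (w - y)"
      have "ereal (a + inner v w) + ereal (q w) \<le> h w"
        unfolding h_def by (intro add_right_mono minorant)
      also have "\<dots> \<le> ereal c" using that c by simp
      finally have "q w \<le> (c - a - inner v y) + inner (- v) (w - y)"
        by (simp add: inner_diff_right)
      also have "\<dots> \<le> \<bar>c - a - inner v y\<bar> * r + norm v * r"
      proof (rule add_mono)
        have "\<bar>c - a - inner v y\<bar> * 1 \<le> \<bar>c - a - inner v y\<bar> * r"
          using False by (intro mult_left_mono) (auto simp: r_def)
        then show "c - a - inner v y \<le> \<bar>c - a - inner v y\<bar> * r"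
          by (metis abs_ge_self mult.right_neutral order_trans)
        show "inner (- v) (w - y) \<le> norm v * r"
          using norm_cauchy_schwarz[of "- v" "w - y"] by (simp add: r_def)
      qed
      finally have "r * r \<le> (2 * \<gamma> * K) * r"
        using \<open>\<gamma> > 0\<close> by (simp add: q_def K_def r_def power2_eq_square field_simps)
      then have "r \<le> 2 * \<gamma> * K"
        by (rule mult_right_le_imp_le) (use False in \<open>auto simp: r_def\<close>)
      then show ?thesis by (simp add: r_def)
    qed
    then show "bounded {w. h w \<le> h w0}"
      by (auto simp: bounded_any_center[where a = y] dist_norm norm_minus_commute)
  qed blast
  then have "\<exists>z. is_arg_min h (\<lambda>_. True) z"
    by (simp add: is_arg_min_linorder)
  then have "is_arg_min h (\<lambda>_. True) (arg_min h (\<lambda>_. True))"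
    unfolding arg_min_def by (rule someI_ex)
  then have "h (prox \<gamma> g y) \<le> h w"
    by (simp add: is_arg_min_linorder prox_def h_def[abs_def] q_def)
  then show ?thesis by (simp add: h_def q_def)
qed

section \<open>The envelope at the forward-backward point\<close>

text \<open>Completing the square turns the model minimized in the envelope into the proximal
  objective plus a constant \<open>b\<close>, so the proximal point attains the infimum.\<close>

lemma fbe_eq_fb_T:
  assumes "\<gamma> > 0"
    and min: "\<And>w. g (fb_T \<gamma> f g x) + ereal (1 / (2 * \<gamma>) * (norm (fb_T \<gamma> f g x - (x - \<gamma> *\<^sub>R grad f x)))\<^sup>2)
      \<le> g w + ereal (1 / (2 * \<gamma>) * (norm (w - (x - \<gamma> *\<^sub>R grad f x)))\<^sup>2)"
    and gz: "g (fb_T \<gamma> f g x) = ereal c"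
  shows "fbe \<gamma> f g x = f x + inner (grad f x) (fb_T \<gamma> f g x - x) + \<gamma> / 2 * (norm (fb_R \<gamma> f g x))\<^sup>2 + c"
proof -
  define z where "z = fb_T \<gamma> f g x"
  define m where "m w = f x + inner (grad f x) (w - x) + 1 / (2 * \<gamma>) * (norm (w - x))\<^sup>2" for w
  define b where "b = f x - \<gamma> / 2 * (norm (grad f x))\<^sup>2"
  have "norm (w - (x - \<gamma> *\<^sub>R grad f x)) ^ 2
      = norm (w - x) ^ 2 + 2 * \<gamma> * inner (grad f x) (w - x) + \<gamma>\<^sup>2 * norm (grad f x) ^ 2" for w
    unfolding power2_norm_eq_inner
    by (simp add: inner_diff inner_add algebra_simps inner_commute power2_eq_square)
  then have complete_square: "m w = 1 / (2 * \<gamma>) * (norm (w - (x - \<gamma> *\<^sub>R grad f x)))\<^sup>2 + b" for w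
    using \<open>\<gamma> > 0\<close> by (simp add: m_def b_def field_simps power2_eq_square)
  have "ereal (m z) + g z \<le> ereal (m w) + g w" for w
    using add_right_mono[OF min[of w], of "ereal b"]
    unfolding complete_square z_def by (simp add: ac_simps flip: plus_ereal.simps(1))
  then have "(INF w. ereal (m w) + g w) = ereal (m z) + g z"
    by (intro antisym INF_greatest INF_lower) auto
  moreover have "1 / (2 * \<gamma>) * (norm (z - x))\<^sup>2 = \<gamma> / 2 * (norm (fb_R \<gamma> f g x))\<^sup>2"
    using \<open>\<gamma> > 0\<close>
    by (simp add: fb_R_def z_def norm_minus_commute[of x] power_divide power2_eq_square)
  ultimately show ?thesis
    by (simp add: fbe_def m_def gz z_def)
qed

section \<open>Minimizers and quadratic growth\<close>

text \<open>Properness makes the value at a minimizer finite, so the conversion to a real in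
  \<open>inf_val\<close> is faithful.\<close>

lemma argmin_set_eq_inf_val:
  assumes "proper_ereal \<phi>" "argmin_set \<phi> \<noteq> {}"
  shows "argmin_set \<phi> = {x. \<phi> x = ereal (inf_val \<phi>)}" and "ereal (inf_val \<phi>) \<le> \<phi> y"
proof -
  obtain p where p: "\<phi> p \<le> \<phi> x" for x
    using assms(2) by (auto simp: argmin_set_def is_arg_min_linorder)
  obtain w where "\<phi> w \<noteq> \<infinity>" using assms(1) by (auto simp: proper_ereal_def)
  then have "\<phi> p \<noteq> \<infinity>" "\<phi> p \<noteq> -\<infinity>"
    using p[of w] assms(1) by (auto simp: proper_ereal_def)
  moreover have "(INF x. \<phi> x) = \<phi> p"
    by (intro antisym INF_greatest INF_lower p) auto
  ultimately have v: "ereal (inf_val \<phi>) = \<phi> p"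
    by (auto simp: inf_val_def ereal_real)
  then show "argmin_set \<phi> = {x. \<phi> x = ereal (inf_val \<phi>)}" "ereal (inf_val \<phi>) \<le> \<phi> y"
    using p by (auto simp: argmin_set_def is_arg_min_linorder intro: antisym)
qed

lemma quadratic_growth_extend:
  fixes \<phi> :: "'a::euclidean_space \<Rightarrow> ereal"
  assumes proper: "proper_ereal \<phi>" and cvx: "convex_ereal \<phi>"
    and ne: "argmin_set \<phi> \<noteq> {}" and cl: "closed (argmin_set \<phi>)"
    and growth: "quadratic_growth \<phi> \<mu> \<beta>" and "\<mu> \<ge> 0" "0 < \<beta>" "\<beta> \<le> B"
  shows "quadratic_growth \<phi> (\<mu> * \<beta> / B) B"
  unfolding quadratic_growth_def
proof (intro allI impI)
  fix z assume zB: "\<phi> z \<le> ereal (inf_val \<phi> + B)"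
  let ?s = "inf_val \<phi>" and ?X = "argmin_set \<phi>"
  note s = argmin_set_eq_inf_val[OF proper ne]
  have "\<phi> z \<noteq> -\<infinity>" using proper by (simp add: proper_ereal_def)
  then obtain pz where pz: "\<phi> z = ereal pz" using zB by (cases "\<phi> z") auto
  have "\<mu> * \<beta> / B \<le> \<mu>"
    using assms(6-8) mult_left_mono[of \<beta> B \<mu>] by (simp add: field_simps)
  have "\<mu> * \<beta> / B / 2 * (infdist z ?X)\<^sup>2 \<le> pz - ?s"
  proof (cases "pz \<le> ?s + \<beta>")
    case True
    then have "\<mu> / 2 * (infdist z ?X)\<^sup>2 \<le> pz - ?s"
      using growth pz unfolding quadratic_growth_def by (metis ereal_less_eq(3) ereal_minus(1))
    moreover have "\<mu> * \<beta> / B / 2 * (infdist z ?X)\<^sup>2 \<le> \<mu> / 2 * (infdist z ?X)\<^sup>2"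
      using \<open>\<mu> * \<beta> / B \<le> \<mu>\<close> by (intro mult_right_mono) auto
    ultimately show ?thesis by linarith
  next
    case False
    obtain p where p: "p \<in> ?X" "infdist z ?X = dist z p"
      using infdist_attains_inf[OF cl ne] by blast
    define e where "e = pz - ?s"
    \<comment> \<open>This fraction is chosen so that convexity places \<open>w\<close> exactly
      within the level \<open>\<beta>\<close> where growth is available:
      \<open>t * e = \<beta>\<close>.\<close>
    define t where "t = \<beta> / e"
    define w where "w = (1 - t) *\<^sub>R p + t *\<^sub>R z"
    have e: "\<beta> < e" "e \<le> B" using False zB pz by (auto simp: e_def)
    then have t: "0 < t" "t < 1" and te: "t * e = \<beta>" and tB: "\<beta> / B \<le> t"
      using \<open>0 < \<beta>\<close> by (auto simp: t_def frac_le)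
    have "\<phi> w \<le> ereal (1 - t) * \<phi> p + ereal t * \<phi> z"
      using cvx t unfolding convex_ereal_def w_def by simp
    also have "\<dots> = ereal (?s + t * e)"
      using p(1) pz s(1) by (simp add: e_def algebra_simps)
    finally have w: "\<phi> w \<le> ereal (?s + t * e)" .
    moreover have "\<phi> w \<noteq> -\<infinity>" using proper by (simp add: proper_ereal_def)
    ultimately obtain pw where pw: "\<phi> w = ereal pw" by (cases "\<phi> w") auto
    have "\<phi> w \<le> ereal (?s + \<beta>)" using w te by simp
    then have "ereal (\<mu> / 2 * (infdist w ?X)\<^sup>2) \<le> \<phi> w - ereal ?s"
      using growth unfolding quadratic_growth_def by blast
    then have 1: "\<mu> / 2 * (infdist w ?X)\<^sup>2 \<le> t * e"
      using w pw by simp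
    have "dist z w = (1 - t) * dist z p"
    proof -
      have "z - w = (1 - t) *\<^sub>R (z - p)" by (simp add: w_def algebra_simps)
      then show ?thesis using t by (simp add: dist_norm)
    qed
    \<comment> \<open>The triangle inequality gives
      \<open>infdist z ?X \<le> infdist w ?X + (1 - t) * infdist z ?X\<close>, because
      \<open>p\<close> is nearest to \<open>z\<close>.\<close>
    then have "t * infdist z ?X \<le> infdist w ?X"
      using infdist_triangle[of z ?X w] p(2) by (simp add: algebra_simps)
    then have "(t * infdist z ?X)\<^sup>2 \<le> (infdist w ?X)\<^sup>2"
      using t by (intro power_mono) (auto simp: infdist_nonneg)
    then have "\<mu> / 2 * (t * infdist z ?X)\<^sup>2 \<le> t * e"
      using 1 \<open>\<mu> \<ge> 0\<close> mult_left_mono[of _ _ "\<mu> / 2"] by fastforce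
    \<comment> \<open>The squared distance carries \<open>t\<close> twice and the gap once;
      cancelling one factor leaves \<open>t\<close>, which is at least
      \<open>\<beta> / B\<close>.\<close>
    then have "t * (\<mu> / 2 * t * (infdist z ?X)\<^sup>2) \<le> t * e"
      by (simp add: power2_eq_square algebra_simps)
    then have "\<mu> / 2 * t * (infdist z ?X)\<^sup>2 \<le> e"
      using t by simp
    moreover have "\<mu> / 2 * (\<beta> / B) * (infdist z ?X)\<^sup>2 \<le> \<mu> / 2 * t * (infdist z ?X)\<^sup>2"
      using tB \<open>\<mu> \<ge> 0\<close> by (intro mult_right_mono mult_left_mono) auto
    ultimately have "\<mu> / 2 * (\<beta> / B) * (infdist z ?X)\<^sup>2 \<le> e" by linarith
    then show ?thesis by (simp add: e_def)
  qed
  then show "ereal (\<mu> * \<beta> / B / 2 * (infdist z ?X)\<^sup>2) \<le> \<phi> z - ereal ?s"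
    by (simp add: pz)
qed

lemma quadratic_growth_mono:
  assumes "quadratic_growth \<phi> \<mu> \<beta>" "\<mu>' \<le> \<mu>" "\<beta>' \<le> \<beta>"
  shows "quadratic_growth \<phi> \<mu>' \<beta>'"
  unfolding quadratic_growth_def
proof (intro allI impI)
  fix x assume "\<phi> x \<le> ereal (inf_val \<phi> + \<beta>')"
  then have "\<phi> x \<le> ereal (inf_val \<phi> + \<beta>)"
    using assms(3) by (meson add_left_mono ereal_less_eq(3) order_trans)
  then have "ereal (\<mu> / 2 * (infdist x (argmin_set \<phi>))\<^sup>2) \<le> \<phi> x - ereal (inf_val \<phi>)"
    using assms(1) unfolding quadratic_growth_def by blast
  moreover have "\<mu>' / 2 * (infdist x (argmin_set \<phi>))\<^sup>2 \<le> \<mu> / 2 * (infdist x (argmin_set \<phi>))\<^sup>2"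
    using assms(2) by (intro mult_right_mono) auto
  ultimately show "ereal (\<mu>' / 2 * (infdist x (argmin_set \<phi>))\<^sup>2) \<le> \<phi> x - ereal (inf_val \<phi>)"
    by (meson ereal_less_eq(3) order_trans)
qed

text \<open>With \<open>e\<close> the gap and \<open>d\<close> the distance to the minimizers,
  growth and the subgradient inequality give
  \<open>\<mu> / 2 * d\<^sup>2 \<le> e \<le> norm v * d\<close>. Hence
  \<open>d \<le> 2 / \<mu> * norm v\<close>, which is put back into the upper bound.\<close>

lemma quadratic_growth_subgradient_bound:
  fixes \<phi> :: "'a::euclidean_space \<Rightarrow> ereal"
  assumes proper: "proper_ereal \<phi>" and ne: "argmin_set \<phi> \<noteq> {}"
    and cl: "closed (argmin_set \<phi>)"
    and growth: "quadratic_growth \<phi> \<mu> \<beta>" "\<mu> > 0"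
    and z: "\<phi> z = ereal c" "c \<le> inf_val \<phi> + \<beta>"
    and v: "\<And>w. ereal (c + inner v (w - z)) \<le> \<phi> w"
  shows "c - inf_val \<phi> \<le> 2 / \<mu> * (norm v)\<^sup>2"
proof -
  let ?X = "argmin_set \<phi>"
  obtain p where p: "p \<in> ?X" "infdist z ?X = dist z p"
    using infdist_attains_inf[OF cl ne] by blast
  define e where "e = c - inf_val \<phi>"
  define d where "d = dist z p"
  have "\<phi> p = ereal (inf_val \<phi>)"
    using p(1) argmin_set_eq_inf_val[OF proper ne] by blast
  then have "e \<le> inner v (z - p)"
    using v[of p] by (simp add: e_def inner_diff_right)
  also have "\<dots> \<le> norm v * d"
    unfolding d_def dist_norm by (rule norm_cauchy_schwarz)
  finally have e: "e \<le> norm v * d" .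
  have "\<mu> / 2 * d\<^sup>2 \<le> e"
    using growth(1) z p(2) unfolding quadratic_growth_def e_def d_def
    by (metis ereal_less_eq(3) ereal_minus(1))
  then have "(\<mu> / 2 * d) * d \<le> norm v * d" using e by (simp add: power2_eq_square)
  then have "\<mu> / 2 * d \<le> norm v"
    by (cases "d = 0") (auto simp: d_def)
  then have "norm v * d \<le> norm v * (2 / \<mu> * norm v)"
    using growth(2) by (intro mult_left_mono) (auto simp: field_simps)
  then have "e \<le> norm v * (2 / \<mu> * norm v)" using e by linarith
  then show ?thesis by (simp add: e_def power2_eq_square mult.left_commute)
qed

text \<open>Closedness is what later yields a nearest minimizer. It holds because being a minimizer
  amounts to \<open>g\<close> lying below the continuous function
  \<open>inf_val \<phi> - f\<close>.\<close>

lemma argmin_set_sum: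
  fixes f :: "'a::real_inner \<Rightarrow> real" and g \<phi> :: "'a \<Rightarrow> ereal"
  defines "\<phi> \<equiv> \<lambda>z. ereal (f z) + g z"
  assumes f: "convex_on UNIV f" "continuous_on UNIV f"
    and g: "proper_ereal g" "convex_ereal g" "lsc_ereal g"
    and ne: "argmin_set \<phi> \<noteq> {}"
  shows "proper_ereal \<phi>" "convex_ereal \<phi>" "closed (argmin_set \<phi>)"
proof -
  have ninf: "g z \<noteq> -\<infinity>" for z using g(1) by (simp add: proper_ereal_def)
  show proper: "proper_ereal \<phi>"
    using g(1) by (auto simp: proper_ereal_def \<phi>_def)
  show "convex_ereal \<phi>"
    unfolding convex_ereal_def
  proof (intro allI ballI)
    fix y z :: 'a and t :: real assume t: "t \<in> {0<..<1}"
    let ?w = "(1 - t) *\<^sub>R y + t *\<^sub>R z"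
    have "\<phi> ?w \<le> ereal ((1 - t) * f y + t * f z) + (ereal (1 - t) * g y + ereal t * g z)"
      unfolding \<phi>_def using t g(2) convex_onD[OF f(1), of t y z]
      by (intro add_mono) (auto simp: convex_ereal_def)
    also have "\<dots> = ereal (1 - t) * \<phi> y + ereal t * \<phi> z"
      using t ninf[of y] ninf[of z] unfolding \<phi>_def
      by (cases "g y"; cases "g z") (auto simp: algebra_simps)
    finally show "\<phi> ?w \<le> ereal (1 - t) * \<phi> y + ereal t * \<phi> z" .
  qed
  have "\<phi> z = ereal (inf_val \<phi>) \<longleftrightarrow> g z \<le> ereal (inf_val \<phi> - f z)" for z
    using argmin_set_eq_inf_val(2)[OF proper ne, of z] unfolding \<phi>_def
    by (cases "g z") auto
  then have "argmin_set \<phi> = {z. g z \<le> ereal (inf_val \<phi> - f z)}"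
    using argmin_set_eq_inf_val(1)[OF proper ne] by simp
  then show "closed (argmin_set \<phi>)"
    using closed_lsc_le_continuous[OF g(3), of "\<lambda>z. inf_val \<phi> - f z"] f(2)
    by (simp add: continuous_intros)
qed

section \<open>The error bound for the envelope\<close>

text \<open>The envelope at \<open>y\<close> lies between \<open>\<phi> z\<close> and
  \<open>\<phi> z + \<gamma> / 2 * (norm r)\<^sup>2\<close>. The lower half keeps \<open>z\<close>
  inside the growth level; the upper half accounts for the summand \<open>\<gamma> / 2\<close>, and
  the subgradient bound at \<open>z\<close> for the other one.\<close>

lemma fbe_error_bound:
  fixes f :: "'a::euclidean_space \<Rightarrow> real" and g \<phi> :: "'a \<Rightarrow> ereal"
  defines "\<phi> \<equiv> \<lambda>z. ereal (f z) + g z"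
  assumes f: "convex_on UNIV f" "\<And>z. f differentiable (at z)" "Lf-lipschitz_on UNIV (grad f)"
    and g: "proper_ereal g" "convex_ereal g" "lsc_ereal g"
    and ne: "argmin_set \<phi> \<noteq> {}"
    and \<gamma>: "\<gamma> > 0" "\<gamma> * Lf \<le> 1"
    and growth: "quadratic_growth \<phi> \<mu> \<beta>" "\<mu> > 0"
    and level: "fbe \<gamma> f g y \<le> inf_val \<phi> + \<beta>"
  shows "fbe \<gamma> f g y - inf_val \<phi> \<le> (\<gamma> / 2 + 2 / \<mu> * (1 + \<gamma> * Lf)\<^sup>2) * (norm (fb_R \<gamma> f g y))\<^sup>2"
proof -
  note D = GDERIV_grad[OF f(2)]
  have cont: "continuous_on UNIV f"
    by (meson f(2) differentiable_imp_continuous_within continuous_at_imp_continuous_on)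
  have ne': "argmin_set (\<lambda>z. ereal (f z) + g z) \<noteq> {}" using ne by (simp add: \<phi>_def)
  note sum = argmin_set_sum[OF f(1) cont g ne', folded \<phi>_def]
  have ninf: "g w \<noteq> -\<infinity>" for w using g(1) by (simp add: proper_ereal_def)
  obtain p where p: "\<phi> p = ereal (inf_val \<phi>)" and p_min: "\<phi> p \<le> \<phi> w" for w
    using ne argmin_set_eq_inf_val[OF sum(1) ne] by auto
  obtain gp where gp: "g p = ereal gp"
    using p ninf[of p] unfolding \<phi>_def by (cases "g p") auto
  have "g p + ereal (inner (- grad f p) (w - p)) \<le> g w" for w
    using p_min by (intro minimizer_sum_variational[OF D g(1,2)]) (simp add: \<phi>_def add.commute)
  then have minorant: "ereal ((gp + inner (grad f p) p) + inner (- grad f p) w) \<le> g w" for w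
    by (simp add: gp inner_diff_right algebra_simps)
  define u where "u = y - \<gamma> *\<^sub>R grad f y"
  define z where "z = fb_T \<gamma> f g y"
  define r where "r = fb_R \<gamma> f g y"
  have z_min: "g z + ereal (1 / (2 * \<gamma>) * (norm (z - u))\<^sup>2) \<le> g w + ereal (1 / (2 * \<gamma>) * (norm (w - u))\<^sup>2)" for w
    using prox_minimizes[OF g(1,3) \<gamma>(1) minorant] by (simp add: z_def fb_T_def u_def)
  have "g z \<noteq> \<infinity>" using z_min[of p] gp by auto
  then obtain gz where gz: "g z = ereal gz" using ninf[of z] by (cases "g z") auto
  have zr: "z - y = - (\<gamma> *\<^sub>R r)" using \<gamma>(1) by (simp add: r_def fb_R_def z_def)
  have fbe: "fbe \<gamma> f g y = f y + inner (grad f y) (z - y) + \<gamma> / 2 * (norm r)\<^sup>2 + gz"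
    using fbe_eq_fb_T[where x = y, OF \<gamma>(1)] z_min gz unfolding z_def u_def r_def by blast
  have nzy: "norm (z - y) = \<gamma> * norm r" using \<gamma>(1) by (simp add: zr)
  \<comment> \<open>Optimality of \<open>z\<close> in the proximal problem yields the subgradient
    \<open>(u - z) / \<gamma>\<close> of \<open>g\<close>, which equals
    \<open>r - grad f y\<close>.\<close>
  have sub_g: "ereal (gz + inner (r - grad f y) (w - z)) \<le> g w" for w
  proof -
    have "- ((2 * (1 / (2 * \<gamma>))) *\<^sub>R (z - u)) = r - grad f y"
      using \<gamma>(1) by (simp add: r_def fb_R_def z_def u_def algebra_simps)
    then show ?thesis
      using minimizer_sum_variational[OF GDERIV_norm_square g(1,2) z_min, of w] gz by simp
  qed
  define v where "v = r - grad f y + grad f z"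
  have sub_\<phi>: "ereal (f z + gz + inner v (w - z)) \<le> \<phi> w" for w
    using add_mono[OF _ sub_g[of w], of "ereal (f z + inner (grad f z) (w - z))" "ereal (f w)"]
      convex_on_GDERIV_above_tangent[OF f(1) D, of z w]
    by (simp add: \<phi>_def v_def inner_add_left algebra_simps)
  have "norm v \<le> norm r + norm (grad f z - grad f y)"
    unfolding v_def using norm_triangle_ineq[of r "grad f z - grad f y"] by (simp add: algebra_simps)
  also have "\<dots> \<le> (1 + \<gamma> * Lf) * norm r"
    using lipschitz_onD[OF f(3), of z y] nzy by (simp add: dist_norm algebra_simps)
  finally have v: "(norm v)\<^sup>2 \<le> ((1 + \<gamma> * Lf) * norm r)\<^sup>2" by (rule power_mono) simp
  have "f z \<le> f y + inner (grad f y) (z - y) + Lf / 2 * (\<gamma> * norm r)\<^sup>2"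
    using lipschitz_gradient_descent[OF D f(3), of z y] by (simp add: nzy)
  moreover have "(\<gamma> * Lf) * (\<gamma> / 2 * (norm r)\<^sup>2) \<le> 1 * (\<gamma> / 2 * (norm r)\<^sup>2)"
    using \<gamma> by (intro mult_right_mono) auto
  \<comment> \<open>The quadratic upper bound on \<open>f\<close> has coefficient
    \<open>Lf / 2\<close>, which \<open>\<gamma> * Lf \<le> 1\<close> makes at most the
    \<open>1 / (2 * \<gamma>)\<close> of the envelope's model.\<close>
  ultimately have "f z + gz \<le> fbe \<gamma> f g y"
    unfolding fbe by (simp add: power2_eq_square algebra_simps)
  then have "f z + gz - inf_val \<phi> \<le> 2 / \<mu> * (norm v)\<^sup>2"
    using level by (intro quadratic_growth_subgradient_bound[OF sum(1) ne sum(3) growth _ _ sub_\<phi>])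
      (auto simp: \<phi>_def gz)
  also have "\<dots> \<le> 2 / \<mu> * ((1 + \<gamma> * Lf) * norm r)\<^sup>2"
    using v growth(2) by (intro mult_left_mono) auto
  also have "\<dots> = 2 / \<mu> * (1 + \<gamma> * Lf)\<^sup>2 * (norm r)\<^sup>2"
    by (simp add: power_mult_distrib)
  finally have "f z + gz - inf_val \<phi> \<le> 2 / \<mu> * (1 + \<gamma> * Lf)\<^sup>2 * (norm r)\<^sup>2" .
  moreover have "fbe \<gamma> f g y \<le> f z + gz + \<gamma> / 2 * (norm r)\<^sup>2"
    unfolding fbe using convex_on_GDERIV_above_tangent[OF f(1) D, of y z] by simp
  ultimately show ?thesis
    unfolding r_def[symmetric] distrib_right by linarith
qed

section \<open>Linear decrease along the iterates\<close>

theorem theorem5p4: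
  fixes f :: "real^'n \<Rightarrow> real" and g :: "real^'n \<Rightarrow> ereal"
    and x :: "nat \<Rightarrow> real^'n"
    and Lf \<gamma> \<sigma> \<eta>bar \<zeta> \<rho> \<nu> \<mu> \<beta> \<mu>' \<phi>star :: real
    and \<phi> :: "real^'n \<Rightarrow> ereal"
  defines "\<phi> \<equiv> \<lambda>z. ereal (f z) + g z"
    and "\<phi>star \<equiv> inf_val \<phi>"
    and "\<mu>' \<equiv> (if fbe \<gamma> f g (x 0) \<le> \<phi>star + \<beta> then \<mu>
               else \<mu> / 2 * min 1 (\<beta> / (fbe \<gamma> f g (x 0) - \<phi>star - \<beta>)))"
  assumes f_convex: "convex_on UNIV f"
    and f_C2: "twice_cont_diff f"
    and Lf_pos: "Lf > 0"
    and f_Lip: "Lf-lipschitz_on UNIV (grad f)"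
    and g_proper: "proper_ereal g"
    and g_convex: "convex_ereal g"
    and g_lsc: "lsc_ereal g"
    and argmin_nonempty: "argmin_set \<phi> \<noteq> {}"
    and \<gamma>_range: "\<gamma> \<in> {0<..<1 / Lf}"
    and \<sigma>_range: "\<sigma> \<in> {0<..<\<gamma> * (1 - \<gamma> * Lf) / 2}"
    and \<eta>bar_range: "\<eta>bar \<in> {0<..<1}"
    and \<zeta>_range: "\<zeta> \<in> {0<..<1}"
    and \<rho>_range: "\<rho> \<in> {0<..1}"
    and \<nu>_range: "\<nu> \<in> {0<..1}"
    and iterates: "\<And>k. fbtn_step \<gamma> \<sigma> \<eta>bar \<zeta> \<rho> \<nu> f g (x k) (x (Suc k))"
    and no_termination: "\<And>k. fb_R \<gamma> f g (x k) \<noteq> 0"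
    and \<mu>_pos: "\<mu> > 0"
    and \<beta>_pos: "\<beta> > 0"
    and growth: "quadratic_growth \<phi> \<mu> \<beta>"
  shows "\<forall>k. fbe \<gamma> f g (x (Suc k)) - \<phi>star \<le>
    (1 - 2 * \<sigma> * \<mu>' / (\<gamma> * \<mu> + 2 * (2 + \<gamma> * \<mu>') * (1 + \<gamma> * Lf)\<^sup>2)) *
      (fbe \<gamma> f g (x k) - \<phi>star)"
proof
  fix k
  define R where "R y = (norm (fb_R \<gamma> f g y))\<^sup>2" for y
  have diff: "f differentiable (at z)" for z
    using f_C2 by (simp add: twice_cont_diff_def)
  then have cont: "continuous_on UNIV f"
    by (meson differentiable_imp_continuous_within continuous_at_imp_continuous_on)
  note sum = argmin_set_sum[OF f_convex cont g_proper g_convex g_lsc argmin_nonempty[unfolded \<phi>_def],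
      folded \<phi>_def]
  have \<gamma>: "\<gamma> > 0" "\<gamma> * Lf \<le> 1"
    using \<gamma>_range Lf_pos by (auto simp: field_simps)
  have step: "fbe \<gamma> f g (x (Suc j)) \<le> fbe \<gamma> f g (x j) - \<sigma> * R (x j)" for j
    using iterates[of j] unfolding fbtn_step_def fbtn_stepsizes_def Let_def R_def by auto
  have "\<sigma> * R (x j) \<ge> 0" for j
    using \<sigma>_range by (simp add: R_def)
  then have "decseq (\<lambda>j. fbe \<gamma> f g (x j))"
    using step by (intro decseq_SucI) (smt (verit))
  then have decr: "fbe \<gamma> f g (x k) \<le> fbe \<gamma> f g (x 0)"
    by (rule decseqD) simp
  \<comment> \<open>The envelope decreases, so this single level covers every iterate; it equals
    \<open>\<beta>\<close> when the initial gap is at most \<open>\<beta>\<close>.\<close>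
  define B where "B = max \<beta> (fbe \<gamma> f g (x 0) - \<phi>star)"
  have "quadratic_growth \<phi> (\<mu> * \<beta> / B) B"
    using \<mu>_pos \<beta>_pos
    by (intro quadratic_growth_extend[OF sum(1,2) argmin_nonempty sum(3) growth]) (auto simp: B_def)
  moreover have \<mu>': "0 < \<mu>'" "\<mu>' \<le> \<mu>" "\<mu>' \<le> \<mu> * \<beta> / B"
  proof -
    define b where "b = fbe \<gamma> f g (x 0) - \<phi>star"
    \<comment> \<open>The threshold is \<open>b = 2 * \<beta>\<close>: up to it the minimum is 1 and
      \<open>1 / 2 \<le> \<beta> / b\<close>; beyond it
      \<open>b \<le> 2 * (b - \<beta>)\<close>.\<close>
    have "1 / 2 * min 1 (\<beta> / (b - \<beta>)) \<le> \<beta> / b" if "b > \<beta>"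
      using that \<beta>_pos by (cases "b \<le> 2 * \<beta>") (auto simp: min_def field_simps)
    then have "\<mu> * (1 / 2 * min 1 (\<beta> / (b - \<beta>))) \<le> \<mu> * (\<beta> / b)" if "b > \<beta>"
      using that \<mu>_pos by (intro mult_left_mono) auto
    moreover have "\<mu>' = (if b \<le> \<beta> then \<mu> else \<mu> / 2 * min 1 (\<beta> / (b - \<beta>)))"
      by (auto simp: \<mu>'_def b_def)
    moreover have "B = max \<beta> b" by (simp add: B_def b_def)
    ultimately show "\<mu>' \<le> \<mu> * \<beta> / B"
      using \<beta>_pos by (auto simp: max_def)
    show "0 < \<mu>'" using \<mu>_pos \<beta>_pos by (simp add: \<mu>'_def)
    show "\<mu>' \<le> \<mu>"
      using \<mu>_pos by (simp add: \<mu>'_def min_le_iff_disj)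
  qed
  ultimately have growth': "quadratic_growth \<phi> \<mu>' B"
    using quadratic_growth_mono by blast
  define A where "A = (1 + \<gamma> * Lf)\<^sup>2"
  define C where "C = \<gamma> * \<mu> + 2 * (2 + \<gamma> * \<mu>') * A"
  define e where "e = fbe \<gamma> f g (x k) - \<phi>star"
  have "e \<le> (\<gamma> / 2 + 2 / \<mu>' * A) * R (x k)"
    unfolding e_def A_def R_def \<phi>star_def \<phi>_def
    using decr growth' \<mu>'(1)
    by (intro fbe_error_bound[OF f_convex diff f_Lip g_proper g_convex g_lsc _ \<gamma>, of _ B])
      (use argmin_nonempty in \<open>auto simp: \<phi>_def B_def \<phi>star_def\<close>)
  \<comment> \<open>Multiplying by \<open>2 * \<mu>'\<close> clears the fraction
    \<open>2 / \<mu>'\<close> and produces the factor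
    \<open>\<gamma> * \<mu>' + 4 * A\<close>.\<close>
  then have "2 * \<mu>' * e \<le> 2 * \<mu>' * ((\<gamma> / 2 + 2 / \<mu>' * A) * R (x k))"
    using \<mu>'(1) by (intro mult_left_mono) auto
  also have "\<dots> = (\<gamma> * \<mu>' + 4 * A) * R (x k)"
    using \<mu>'(1) by (simp add: field_simps)
  \<comment> \<open>The stated denominator \<open>C\<close> is larger: it has
    \<open>\<gamma> * \<mu>\<close> in place of \<open>\<gamma> * \<mu>'\<close> and the additional
    nonnegative term \<open>2 * \<gamma> * \<mu>' * A\<close>.\<close>
  also have "\<dots> \<le> C * R (x k)"
  proof (rule mult_right_mono)
    have "\<gamma> * \<mu>' \<le> \<gamma> * \<mu>" using \<mu>'(2) \<gamma>(1) by (intro mult_left_mono) auto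
    moreover have "0 \<le> \<gamma> * \<mu>' * A" using \<mu>'(1) \<gamma>(1) by (simp add: A_def)
    ultimately show "\<gamma> * \<mu>' + 4 * A \<le> C" by (simp add: C_def algebra_simps)
  qed (simp add: R_def)
  finally have "\<sigma> * (2 * \<mu>' * e) \<le> \<sigma> * (C * R (x k))"
    using \<sigma>_range by (intro mult_left_mono) auto
  moreover have "C > 0"
    using \<gamma>(1) \<mu>_pos \<mu>'(1) by (simp add: C_def A_def add_pos_nonneg)
  ultimately have "2 * \<sigma> * \<mu>' / C * e \<le> \<sigma> * R (x k)"
    by (simp add: field_simps)
  then have "fbe \<gamma> f g (x (Suc k)) - \<phi>star \<le> (1 - 2 * \<sigma> * \<mu>' / C) * e"
    using step[of k] by (simp add: e_def left_diff_distrib)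
  then show "fbe \<gamma> f g (x (Suc k)) - \<phi>star \<le>
    (1 - 2 * \<sigma> * \<mu>' / (\<gamma> * \<mu> + 2 * (2 + \<gamma> * \<mu>') * (1 + \<gamma> * Lf)\<^sup>2)) *
      (fbe \<gamma> f g (x k) - \<phi>star)"
    by (simp only: C_def A_def e_def)
qed

end
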